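(* (1) The operators $\psi_k,\psi^*_k$ ($k\in\mathbb Z$) on $\mathcal B$ satisfy the relations of the Clifford algebra of fermions: for all $k,l\in\mathbb Z$, $$\psi_k\psi_l+\psi_l\psi_k=0,\qquad \psi^*_k\psi^*_l+\psi^*_l\psi^*_k=0,\qquad \psi_k\psi^*_l+\psi^*_l\psi_k=\delta_{k,l}.$$ (2) Let $\lambda=(\lambda_1\ge\lambda_2\ge\dots\ge\lambda_l)$ be a partition with $|\lambda|=\sum_i\lambda_i$, and let $\mu$ be the conjugate partition of $\lambda$. Then $$\psi_{\lambda_1+l}\,\psi_{\lambda_2+l-1}\cdots\psi_{\lambda_{l-1}+2}\,\psi_{\lambda_l+1}(1)=s_\lambda z^l,$$ $$\psi^*_{-\lambda_1-l+1}\cdots\psi^*_{-\lambda_{l-1}-1}\,\psi^*_{-\lambda_l}(1)=(-1)^{|\lambda|}s_\mu z^{-l}.$$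
   Context: Setting. Let $B=\mathbb C[h^{(0)}_1,h^{(0)}_2,\dots]$ be the polynomial ring in independent variables $h^{(0)}_k$ ($k>0$), with $h^{(0)}_0=1$ and $h^{(0)}_k=0$ for $k<0$. $B$ is graded by $\deg h^{(0)}_n=n$, and $B^{\le n}$ is the sum of the homogeneous components of degree $\le n$. Let $\{h^{(r)}_k\}_{k,r\in\mathbb Z}$ be a family of elements of $B$ (extending the $h^{(0)}_k$) with $h^{(r)}_k\in B^{\le k+r}$, $h^{(k)}_{-k}=1$ for all $k\in\mathbb Z$, and $h^{(r)}_k=0$ whenever $k+r<0$. For an integer vector $\lambda=(\lambda_1,\dots,\lambda_l)$ (parts may be negative and in any order), extended by $\lambda_i=0$ for $i>l$, let $s_\lambda\in B$ be the stable value, for large $N$, of $\det\left[h^{(j-1)}_{\lambda_i-i+1}\right]_{1\le i,j\le N}$ (the value is the same for all $N\ge l$). For partitions these are the generalized Schur functions, and it is required that $\{s_\lambda\}$, $\lambda$ ranging over all partitions, is a linear basis of $B$. Let $z$ be a variable, $\mathcal B^{(m)}=z^mB$, $\mathcal B=\bigoplus_{m\in\mathbb Z}\mathcal B^{(m)}=B[z,z^{-1}]$, with linear basis $\{s_\lambda z^m\}$ ($\lambda$ a partition, $m\in\mathbb Z$). The linear operators $\psi_k,\psi_k^*$ on $\mathcal B$ are defined on this basis by $$\psi_k(s_\lambda z^m)=s_{(k-m-1,\lambda_1,\lambda_2,\dots)}z^{m+1},$$ $$\psi^*_k(s_\lambda z^m)=\sum_{t=1}^\infty(-1)^{t+1}\delta_{k-m-1,\,\lambda_t-t}\;s_{(\lambda_1+1,\dots,\lambda_{t-1}+1,\lambda_{t+1},\lambda_{t+2},\dots)}z^{m-1},$$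 where $\lambda_t=0$ for $t$ larger than the number of parts of $\lambda$. *)

theory Defs
  imports "HOL-Library.Poly_Mapping" "Jordan_Normal_Form.Determinant"
begin

text \<open>The monomial \<open>\<alpha>\<close> stands for the product of the powers of \<open>h\<^sup>(\<^sup>0\<^sup>)\<^sub>n\<^sub>+\<^sub>1\<close> with
  exponents \<open>\<alpha> n\<close>, \<open>n = 0, 1, \<dots>\<close>, i.e. the variable with index \<open>n\<close> is
  \<open>h\<^sup>(\<^sup>0\<^sup>)\<^sub>n\<^sub>+\<^sub>1\<close>, of degree \<open>n + 1\<close>. A Laurent polynomial in \<open>z\<close> is the finitely
  supported family of its coefficients.\<close>

type_synonym B = "(nat \<Rightarrow>\<^sub>0 nat) \<Rightarrow>\<^sub>0 complex"
type_synonym BZ = "int \<Rightarrow>\<^sub>0 B"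

definition scaleB :: "complex \<Rightarrow> B \<Rightarrow> B" where
  "scaleB c p = Poly_Mapping.single 0 c * p"

definition scaleBZ :: "complex \<Rightarrow> BZ \<Rightarrow> BZ" where
  "scaleBZ c v = Poly_Mapping.single 0 (Poly_Mapping.single 0 c) * v"

global_interpretation B: vector_space scaleB
  by unfold_locales
     (simp_all add: scaleB_def algebra_simps single_add mult_single flip: mult.assoc)

global_interpretation BZ: vector_space scaleBZ
  by unfold_locales
     (simp_all add: scaleBZ_def algebra_simps single_add mult_single flip: mult.assoc)

definition hvar :: "nat \<Rightarrow> B" where
  "hvar n = Poly_Mapping.single (Poly_Mapping.single (n - 1) 1) 1"

definition wdeg :: "(nat \<Rightarrow>\<^sub>0 nat) \<Rightarrow> nat" where
  "wdeg \<alpha> = (\<Sum>n\<in>Poly_Mapping.keys \<alpha>. (n + 1) * Poly_Mapping.lookup \<alpha> n)"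

definition homog :: "nat \<Rightarrow> B set" where
  "homog d = {p. \<forall>\<alpha>\<in>Poly_Mapping.keys p. wdeg \<alpha> = d}"

definition B_le :: "int \<Rightarrow> B set" where
  "B_le n = B.span (\<Union>d\<in>{d. int d \<le> n}. homog d)"

text \<open>Integer vectors are extended by zeros to sequences and indexed from \<open>0\<close>:
  \<open>\<alpha> i\<close> is the part with number \<open>i + 1\<close>.\<close>

definition int_vec :: "(nat \<Rightarrow> int) \<Rightarrow> nat \<Rightarrow> bool" where
  "int_vec \<alpha> l \<longleftrightarrow> (\<forall>i\<ge>l. \<alpha> i = 0)"

definition partitions :: "(nat \<Rightarrow> int) set" where
  "partitions = {lam. antimono lam \<and> (\<forall>i. 0 \<le> lam i) \<and> (\<exists>l. int_vec lam l)}"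

definition conj_partition :: "(nat \<Rightarrow> int) \<Rightarrow> nat \<Rightarrow> int" where
  "conj_partition lam j = int (card {i. int j + 1 \<le> lam i})"

text \<open>\<open>h r k\<close> is \<open>h\<^sup>(\<^sup>r\<^sup>)\<^sub>k\<close>. With rows and columns counted from \<open>0\<close> the entry
  \<open>h\<^sup>(\<^sup>j\<^sup>-\<^sup>1\<^sup>)\<close> with lower index \<open>\<alpha>\<^sub>i - i + 1\<close> becomes \<open>h j (\<alpha> i - i)\<close>.\<close>

definition schur_det :: "(int \<Rightarrow> int \<Rightarrow> B) \<Rightarrow> (nat \<Rightarrow> int) \<Rightarrow> nat \<Rightarrow> B" where
  "schur_det h \<alpha> N = det (mat N N (\<lambda>(i, j). h (int j) (\<alpha> i - int i)))"

definition gschur :: "(int \<Rightarrow> int \<Rightarrow> B) \<Rightarrow> (nat \<Rightarrow> int) \<Rightarrow> B" where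
  "gschur h \<alpha> = (THE s. eventually (\<lambda>N. schur_det h \<alpha> N = s) sequentially)"

definition gschurz :: "(int \<Rightarrow> int \<Rightarrow> B) \<Rightarrow> (nat \<Rightarrow> int) \<Rightarrow> int \<Rightarrow> BZ" where
  "gschurz h \<alpha> m = Poly_Mapping.single m (gschur h \<alpha>)"

definition prepend :: "int \<Rightarrow> (nat \<Rightarrow> int) \<Rightarrow> nat \<Rightarrow> int" where
  "prepend a \<alpha> i = (case i of 0 \<Rightarrow> a | Suc j \<Rightarrow> \<alpha> j)"

definition remove_part :: "nat \<Rightarrow> (nat \<Rightarrow> int) \<Rightarrow> nat \<Rightarrow> int" where
  "remove_part t \<alpha> i = (if i < t then \<alpha> i + 1 else \<alpha> (i + 1))"

text \<open>When the \<open>s\<^sub>\<lambda>\<close>, \<open>lam\<close> a partition, form a basis of \<open>B\<close>, there is exactly one linear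
  operator with the prescribed values on the basis \<open>s\<^sub>\<lambda> z\<^sup>m\<close>.\<close>

definition psi :: "(int \<Rightarrow> int \<Rightarrow> B) \<Rightarrow> int \<Rightarrow> BZ \<Rightarrow> BZ" where
  "psi h k = (THE T. Vector_Spaces.linear scaleBZ scaleBZ T \<and>
     (\<forall>lam\<in>partitions. \<forall>m.
        T (gschurz h lam m) = gschurz h (prepend (k - m - 1) lam) (m + 1)))"

text \<open>The part with number \<open>t + 1\<close> is \<open>lam t\<close>, so the sign \<open>(-1)\<close> to the power
  \<open>(t + 1) + 1\<close> is \<open>(-1) ^ t\<close>. For a partition \<open>lam\<close> at most one summand is nonzero;
  \<^const>\<open>Sum_any\<close> is the sum of a finitely supported family.\<close>

definition psi_star :: "(int \<Rightarrow> int \<Rightarrow> B) \<Rightarrow> int \<Rightarrow> BZ \<Rightarrow> BZ" where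
  "psi_star h k = (THE T. Vector_Spaces.linear scaleBZ scaleBZ T \<and>
     (\<forall>lam\<in>partitions. \<forall>m.
        T (gschurz h lam m) =
          Sum_any (\<lambda>t. if k - m - 1 = lam t - (int t + 1)
                       then (- 1) ^ t * gschurz h (remove_part t lam) (m - 1) else 0)))"

end

(* The basis vector s_lambda z^m corresponds to the semi-infinite wedge of the vectors with
   indices lambda_i - i + m + 1 (i = 1, 2, ...), which is determined by the set of these indices.
   Since s_alpha is a determinant whose row i depends only on alpha_i - i, it is alternating in
   these numbers. Sorting the vector (k - m - 1, lambda) by row exchanges therefore shows that
   psi_k is the exterior multiplication by the vector k, with the sign given by the number of
   indices above k; psi*_k is the corresponding contraction. The Clifford relations then reduce to
   counting how one insertion or removal changes the number of indices above the other. *)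

theory Submission
  imports Defs
begin

section \<open>Lifting bases of \<open>B\<close> to \<open>BZ\<close>, and rules for signs\<close>

section \<open>Linear operators on the Laurent polynomials\<close>

interpretation BZZ: vector_space_pair scaleBZ scaleBZ ..

lemma poly_mapping_sum_induct [case_names single sum]:
  fixes v :: "'a \<Rightarrow>\<^sub>0 'b::comm_monoid_add"
  assumes single: "\<And>k x. P (Poly_Mapping.single k x)"
    and sum: "\<And>f g. P f \<Longrightarrow> P g \<Longrightarrow> P (f + g)"
  shows "P v"
proof (induction v rule: update_induct)
  case const
  then show ?case using single[of undefined 0] by simp
next
  case (update f a b)
  \<comment> \<open>The key \<open>a\<close> is fresh, so updating there is the same as adding a
    monomial.\<close>
  then have "Poly_Mapping.update a b f = f + Poly_Mapping.single a b"
    by (intro poly_mapping_eqI)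
      (auto simp: lookup_update lookup_add lookup_single in_keys_iff)
  with update single sum show ?case by simp
qed

lemma lookup_scaleBZ: "Poly_Mapping.lookup (scaleBZ c v) m = scaleB c (Poly_Mapping.lookup v m)"
proof (induction v rule: poly_mapping_sum_induct)
  case (single k v)
  then show ?case
    by (simp add: scaleBZ_def scaleB_def mult_single lookup_single when_def)
next
  case (sum f g)
  then show ?case
    by (simp add: lookup_add BZ.scale_right_distrib B.scale_right_distrib)
qed

lemma scaleBZ_single: "scaleBZ c (Poly_Mapping.single m x) = Poly_Mapping.single m (scaleB c x)"
  by (simp add: scaleBZ_def scaleB_def mult_single)

text \<open>Taking the coefficient of \<open>z^m\<close> in a linear relation kills all terms with
  another exponent and leaves a relation inside \<open>S\<close>.\<close>

lemma independent_single:
  assumes "B.independent S"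
  shows "BZ.independent {Poly_Mapping.single m x | m x. x \<in> S}"
  unfolding BZ.independent_explicit_module
proof (intro allI impI)
  fix t u v
  assume t: "finite t" "t \<subseteq> {Poly_Mapping.single m x | m x. x \<in> S}"
    and sum: "(\<Sum>v\<in>t. scaleBZ (u v) v) = 0" and v: "v \<in> t"
  obtain m x where x: "v = Poly_Mapping.single m x" "x \<in> S"
    using t v by auto
  define X where "X = {x\<in>S. Poly_Mapping.single m x \<in> t}"
  have inj: "inj_on (Poly_Mapping.single m) X"
    by (rule inj_onI) (metis lookup_single_eq)
  have fin: "finite X"
    by (rule finite_imageD[OF _ inj], rule finite_subset[OF _ t(1)]) (auto simp: X_def)
  have "0 = Poly_Mapping.lookup (\<Sum>v\<in>t. scaleBZ (u v) v) m"
    by (simp add: sum)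
  also have "\<dots> = (\<Sum>v\<in>t. scaleB (u v) (Poly_Mapping.lookup v m))"
    by (simp add: lookup_sum lookup_scaleBZ)
  also have "\<dots> = (\<Sum>v\<in>Poly_Mapping.single m ` X. scaleB (u v) (Poly_Mapping.lookup v m))"
  proof (rule sum.mono_neutral_right[OF t(1)])
    show "\<forall>v\<in>t - Poly_Mapping.single m ` X. scaleB (u v) (Poly_Mapping.lookup v m) = 0"
    proof
      fix w assume w: "w \<in> t - Poly_Mapping.single m ` X"
      then obtain n y where y: "w = Poly_Mapping.single n y" "y \<in> S"
        using t by auto
      with w have "n \<noteq> m"
        by (auto simp: X_def)
      then show "scaleB (u w) (Poly_Mapping.lookup w m) = 0"
        by (simp add: y lookup_single)
    qed
  qed (auto simp: X_def)
  also have "\<dots> = (\<Sum>x\<in>X. scaleB (u (Poly_Mapping.single m x)) x)"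
    by (simp add: sum.reindex[OF inj])
  finally have "u (Poly_Mapping.single m x) = 0"
    using B.independentD[OF assms fin, of "\<lambda>x. u (Poly_Mapping.single m x)" x] x v
    by (auto simp: X_def)
  then show "u v = 0"
    by (simp add: x)
qed

lemma span_single:
  assumes "B.span S = UNIV"
  shows "BZ.span {Poly_Mapping.single m x | m x. x \<in> S} = UNIV" (is "BZ.span ?E = _")
proof -
  have single: "Poly_Mapping.single m x \<in> BZ.span ?E" for m x
  proof -
    have "x \<in> B.span S"
      by (simp add: assms)
    then show ?thesis
    proof (induction rule: B.span_induct_alt)
      case base
      then show ?case by (simp add: BZ.span_zero)
    next
      case (step c x y)
      then have "scaleBZ c (Poly_Mapping.single m x) \<in> BZ.span ?E"
        by (intro BZ.span_scale BZ.span_base) blast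
      with step show ?case
        by (simp add: single_add scaleBZ_single BZ.span_add)
    qed
  qed
  have "v \<in> BZ.span ?E" for v
    by (induction v rule: poly_mapping_sum_induct) (simp_all only: single BZ.span_add)
  then show ?thesis by blast
qed

text \<open>Signs are written as powers of the ring element \<open>- 1\<close> of \<open>BZ\<close>,
  not as scalars, so linearity alone does not move them past \<open>T\<close> syntactically.\<close>

lemma minus_one_power_commute:
  assumes "Vector_Spaces.linear scaleBZ scaleBZ T"
  shows "T ((- 1) ^ n * v) = (- 1) ^ n * T v"
  by (cases "even n") (simp_all add: BZZ.linear_neg[OF assms])

lemma signs_cancel:
  assumes "odd (a + b)"
  shows "(- 1) ^ a * v + (- 1) ^ b * v = (0 :: 'a :: ring_1)"
  using assms by (cases "even a") simp_all

section \<open>Sets of wedge indices given by a partition and a charge; their insertions and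
  removals\<close>

section \<open>Maya diagrams\<close>

text \<open>With rows counted from 0 this is the wedge index
  \<open>lambda_(i+1) - (i+1) + m + 1\<close>; \<open>m\<close> is the charge.\<close>

definition beads :: "(nat \<Rightarrow> int) \<Rightarrow> int \<Rightarrow> nat \<Rightarrow> int" where
  "beads lam m i = lam i - int i + m"

definition maya :: "(nat \<Rightarrow> int) \<Rightarrow> int \<Rightarrow> int set" where
  "maya lam m = range (beads lam m)"

text \<open>\<open>card\<close> is 0 on infinite sets, so the counting rules below carry a
  finiteness hypothesis; Maya diagrams satisfy it because the bead of row 0 is maximal.\<close>

definition num_above :: "int \<Rightarrow> int set \<Rightarrow> nat" where
  "num_above k S = card {x\<in>S. k < x}"

text \<open>For \<open>p = 0\<close> this is \<^const>\<open>prepend\<close>; moving the new bead past \<open>p\<close> others by row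
  exchanges of the determinant moves each of these up one row, so its part drops by one.\<close>

definition insert_part :: "nat \<Rightarrow> int \<Rightarrow> (nat \<Rightarrow> int) \<Rightarrow> nat \<Rightarrow> int" where
  "insert_part p a lam i =
     (if i < p then lam i - 1 else if i = p then a + int p else lam (i - 1))"

lemma insert_part_0: "insert_part 0 a lam = prepend a lam"
  by (auto simp: insert_part_def prepend_def fun_eq_iff split: nat.splits)

lemma beads_less_iff:
  assumes "lam \<in> partitions"
  shows "beads lam m i < beads lam m j \<longleftrightarrow> j < i"
proof -
  have less: "beads lam m i < beads lam m j" if "j < i" for i j
    using that assms antimonoD[of lam j i] by (auto simp: partitions_def beads_def)
  show ?thesis
    using less[of i j] less[of j i] by (metis linorder_neqE_nat order_less_asym less_irrefl)
qed

lemma beads_eq_iff: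
  assumes "lam \<in> partitions"
  shows "beads lam m i = beads lam m j \<longleftrightarrow> i = j"
  using beads_less_iff[OF assms, of m i j] beads_less_iff[OF assms, of m j i]
  by (metis linorder_neqE_nat less_irrefl)

text \<open>Strictly decreasing integers \<open>lam i - i\<close> force weakly decreasing parts, and
  a weakly decreasing sequence ending in zeros is nonnegative.\<close>

lemma partitionsI:
  assumes "int_vec lam l" "\<And>i. beads lam m (Suc i) < beads lam m i"
  shows "lam \<in> partitions"
proof -
  have "lam (Suc i) \<le> lam i" for i
    using assms(2)[of i] by (simp add: beads_def)
  then have anti: "antimono lam"
    by (rule decseq_SucI)
  have "0 \<le> lam i" for i
    using antimonoD[OF anti, of i "max i l"] assms(1) by (simp add: int_vec_def)
  with anti assms(1) show ?thesis
    by (auto simp: partitions_def)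
qed

lemma partitionsE:
  assumes "lam \<in> partitions"
  obtains l where "int_vec lam l"
  using assms by (auto simp: partitions_def)

text \<open>Once the earlier values agree, the value at \<open>n\<close> is, for both sequences, the
  largest remaining element of the common range.\<close>

lemma strict_decseq_range_eq:
  fixes f g :: "nat \<Rightarrow> int"
  assumes f: "\<And>i j. f i < f j \<longleftrightarrow> j < i" and g: "\<And>i j. g i < g j \<longleftrightarrow> j < i"
    and range: "range f = range g"
  shows "f n = g n"
proof (induction n rule: less_induct)
  case (less n)
  obtain i where i: "g n = f i" using range by (metis rangeE rangeI)
  obtain j where j: "f n = g j" using range by (metis rangeE rangeI)
  have "n \<le> i" using less[of i] i g[of n i] by (metis less_irrefl not_le)
  moreover have "n \<le> j" using less[of j] j f[of n j] by (metis less_irrefl not_le)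
  ultimately show ?case
    using i j f[of n i] g[of n j] by (metis linorder_not_less order_antisym)
qed

text \<open>The decreasing enumeration recovers all beads; far down both parts vanish, which reveals
  the charge and then the parts.\<close>

lemma maya_inject:
  assumes "lam \<in> partitions" "mu \<in> partitions" "maya lam m = maya mu n"
  shows "lam = mu" "m = n"
proof -
  have eq: "beads lam m i = beads mu n i" for i
    using assms by (intro strict_decseq_range_eq) (auto simp: beads_less_iff maya_def)
  obtain l l' where "int_vec lam l" "int_vec mu l'"
    using assms by (auto elim!: partitionsE)
  then show "m = n"
    using eq[of "max l l'"] by (simp add: beads_def int_vec_def)
  with eq show "lam = mu"
    by (simp add: beads_def fun_eq_iff)
qed

lemma finite_above:
  assumes "lam \<in> partitions"
  shows "finite {x\<in>maya lam m. k < x}"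
proof (rule finite_subset)
  show "{x\<in>maya lam m. k < x} \<subseteq> {k..beads lam m 0}"
    using beads_less_iff[OF assms, of m 0] by (auto simp: maya_def not_less)
qed simp

lemma num_above_beads:
  assumes "lam \<in> partitions" "\<And>i. k < beads lam m i \<longleftrightarrow> i < p"
  shows "num_above k (maya lam m) = p"
proof -
  have "{x\<in>maya lam m. k < x} = beads lam m ` {..<p}"
    using assms(2) by (auto simp: maya_def)
  moreover have "inj_on (beads lam m) {..<p}"
    by (rule inj_onI) (simp add: beads_eq_iff assms(1))
  ultimately show ?thesis
    by (simp add: num_above_def card_image)
qed

lemma num_above_insert:
  assumes "finite {x\<in>S. k < x}" "l \<notin> S"
  shows "num_above k (insert l S) = num_above k S + (if k < l then 1 else 0)"
proof (cases "k < l")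
  case True
  then have "{x\<in>insert l S. k < x} = insert l {x\<in>S. k < x}" by auto
  with True assms show ?thesis by (simp add: num_above_def)
next
  case False
  then have "{x\<in>insert l S. k < x} = {x\<in>S. k < x}" by auto
  with False show ?thesis by (simp add: num_above_def)
qed

lemma num_above_remove:
  assumes "finite {x\<in>S. k < x}" "l \<in> S"
  shows "num_above k S = num_above k (S - {l}) + (if k < l then 1 else 0)"
proof -
  have "finite {x \<in> S - {l}. k < x}"
    by (rule finite_subset[OF _ assms(1)]) auto
  from num_above_insert[OF this, of l] show ?thesis
    using assms(2) by (simp add: insert_absorb)
qed

text \<open>The new bead \<open>k\<close> takes the position given by the number of beads above it,
  and the lower beads move down one row. Raising the charge by one is offset by the shifts in
  \<open>insert_part\<close>.\<close>

lemma insert_bead: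
  assumes lam: "lam \<in> partitions" and k: "k \<notin> maya lam m"
  defines "mu \<equiv> insert_part (num_above k (maya lam m)) (k - m - 1) lam"
  shows "mu \<in> partitions" "maya mu (m + 1) = insert k (maya lam m)"
proof -
  obtain l where l: "int_vec lam l"
    using lam by (rule partitionsE)
  define p where "p = (LEAST i. beads lam m i \<le> k)"
  \<comment> \<open>In a row \<open>i \<ge> l\<close> the bead is \<open>m - i\<close>, which is at
    most \<open>k\<close> once also \<open>i \<ge> m - k\<close>; so the \<open>LEAST\<close> is
    attained.\<close>
  have "beads lam m (l + nat (m - k)) \<le> k"
    using l by (auto simp: beads_def int_vec_def)
  then have p: "beads lam m p \<le> k"
    unfolding p_def by (rule LeastI)
  have p_iff: "k < beads lam m i \<longleftrightarrow> i < p" for i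
  proof
    assume "k < beads lam m i"
    with p have "beads lam m p < beads lam m i" by simp
    then show "i < p" by (simp add: beads_less_iff[OF lam])
  next
    assume "i < p"
    then show "k < beads lam m i"
      unfolding p_def by (metis not_less_Least not_le)
  qed
  have neq: "beads lam m i \<noteq> k" for i
    using k by (auto simp: maya_def)
  have mu: "mu = insert_part p (k - m - 1) lam"
    by (simp add: mu_def num_above_beads[OF lam p_iff])
  have beads_mu: "beads mu (m + 1) i =
      (if i < p then beads lam m i else if i = p then k else beads lam m (i - 1))" for i
    by (auto simp: mu insert_part_def beads_def)
  show "mu \<in> partitions"
  proof (rule partitionsI)
    show "int_vec mu (Suc (l + p))"
      using l by (auto simp: mu insert_part_def int_vec_def)
    fix i
    consider "Suc i < p" | "Suc i = p" | "i = p" | "p < i" by linarith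
    then show "beads mu (m + 1) (Suc i) < beads mu (m + 1) i"
    proof cases
      \<comment> \<open>Directly below the new bead lies the old bead of row \<open>p\<close>, which
        is at most \<open>k\<close> and differs from \<open>k\<close>.\<close>
      case 3
      then show ?thesis using p neq[of p] by (simp add: beads_mu)
    qed (auto simp: beads_mu beads_less_iff[OF lam] p_iff)
  qed
  show "maya mu (m + 1) = insert k (maya lam m)"
  proof (intro equalityI subsetI)
    fix x assume "x \<in> maya mu (m + 1)"
    then show "x \<in> insert k (maya lam m)"
      by (auto simp: maya_def beads_mu split: if_splits)
  next
    fix x assume "x \<in> insert k (maya lam m)"
    then consider "x = k" | i where "x = beads lam m i"
      by (auto simp: maya_def)
    then show "x \<in> maya mu (m + 1)"
    proof cases
      case 1
      then have "x = beads mu (m + 1) p" by (simp add: beads_mu)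
      then show ?thesis by (simp add: maya_def)
    next
      case (2 i)
      then have "x = beads mu (m + 1) (if i < p then i else Suc i)" by (simp add: beads_mu)
      then show ?thesis by (simp add: maya_def)
    qed
  qed
qed

text \<open>Rows above \<open>t\<close> gain one to offset the lower charge; rows below
  \<open>t\<close> move up by one, which offsets it as well.\<close>

lemma remove_bead:
  assumes lam: "lam \<in> partitions"
  shows "remove_part t lam \<in> partitions"
    and "maya (remove_part t lam) (m - 1) = maya lam m - {beads lam m t}"
proof -
  obtain l where l: "int_vec lam l"
    using lam by (rule partitionsE)
  have beads_rem: "beads (remove_part t lam) (m - 1) i =
      (if i < t then beads lam m i else beads lam m (Suc i))" for i m
    by (auto simp: remove_part_def beads_def)
  show "remove_part t lam \<in> partitions"
  proof (rule partitionsI)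
    show "int_vec (remove_part t lam) (l + t)"
      using l by (auto simp: remove_part_def int_vec_def)
    show "beads (remove_part t lam) (m - 1) (Suc i) < beads (remove_part t lam) (m - 1) i" for i
      by (auto simp: beads_rem beads_less_iff[OF lam])
  qed
  show "maya (remove_part t lam) (m - 1) = maya lam m - {beads lam m t}"
  proof (intro equalityI subsetI)
    fix x assume "x \<in> maya (remove_part t lam) (m - 1)"
    then show "x \<in> maya lam m - {beads lam m t}"
      by (auto simp: maya_def beads_rem beads_eq_iff[OF lam])
  next
    fix x assume "x \<in> maya lam m - {beads lam m t}"
    then obtain i where i: "x = beads lam m i" "i \<noteq> t"
      by (auto simp: maya_def)
    then have "x = beads (remove_part t lam) (m - 1) (if i < t then i else i - 1)"
      by (auto simp: beads_rem)
    then show "x \<in> maya (remove_part t lam) (m - 1)"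
      by (simp add: maya_def)
  qed
qed

lemma partitions_shift:
  assumes "lam \<in> partitions"
  shows "(\<lambda>i. lam (i + j)) \<in> partitions"
proof -
  obtain l where "int_vec lam l"
    using assms by (rule partitionsE)
  then have "int_vec (\<lambda>i. lam (i + j)) l"
    by (simp add: int_vec_def)
  moreover have "antimono (\<lambda>i. lam (i + j))"
    using assms by (auto simp: partitions_def monotone_def)
  ultimately show ?thesis
    using assms by (auto simp: partitions_def)
qed

text \<open>Removing the (zero) part with number \<open>\<lambda>\<^sub>1 + 1\<close> from the conjugate of
  \<open>(\<lambda>\<^sub>2, \<lambda>\<^sub>3, \<dots>)\<close> increases the first \<open>\<lambda>\<^sub>1\<close> parts by one, so each
  \<open>\<psi>\<^sup>*\<close> in the second part of the theorem adds one row to \<open>\<lambda>\<close>, with sign \<open>(-1)\<close> to the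
  power of its length.\<close>

lemma conj_partition_Suc:
  assumes lam: "lam \<in> partitions"
  shows "conj_partition lam = remove_part (nat (lam 0)) (conj_partition (\<lambda>i. lam (Suc i)))"
proof
  fix j
  let ?T = "\<lambda>c. {i. c \<le> lam (Suc i)}"
  obtain l where l: "int_vec lam l"
    using lam by (rule partitionsE)
  have fin: "finite (?T (int j + 1))" for j
  proof (rule finite_subset)
    show "?T (int j + 1) \<subseteq> {..<l}"
      by (rule subsetI, rule ccontr) (use l in \<open>auto simp: int_vec_def\<close>)
  qed simp
  have le: "lam i \<le> lam 0" "0 \<le> lam i" for i
    using lam antimonoD[of lam 0 i] by (auto simp: partitions_def)
  \<comment> \<open>Row 0 is separated from the remaining rows, which are shifted by
    \<open>Suc\<close>.\<close>
  have split: "{i. c \<le> lam i} = (if c \<le> lam 0 then insert 0 (Suc ` ?T c) else Suc ` ?T c)" for c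
  proof (rule Set.set_eqI)
    fix i
    show "i \<in> {i. c \<le> lam i} \<longleftrightarrow>
        i \<in> (if c \<le> lam 0 then insert 0 (Suc ` ?T c) else Suc ` ?T c)"
      by (cases i) auto
  qed
  show "conj_partition lam j =
      remove_part (nat (lam 0)) (conj_partition (\<lambda>i. lam (Suc i))) j"
  proof (cases "int j + 1 \<le> lam 0")
    case True
    then have "j < nat (lam 0)" by linarith
    with True show ?thesis
      using fin[of j]
      by (simp add: conj_partition_def remove_part_def split[of "int j + 1"] card_image)
  next
    case False
    \<comment> \<open>Columns beyond the first row are empty, so both sides are 0 here.\<close>
    have "\<not> int j + 1 \<le> lam i" "\<not> int (j + 1) + 1 \<le> lam i" for i
      using le(1)[of i] False by linarith+
    then have "{i. int j + 1 \<le> lam i} = {}" "?T (int (j + 1) + 1) = {}"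
      by blast+
    moreover have "\<not> j < nat (lam 0)"
      using False by linarith
    ultimately show ?thesis
      by (simp add: conj_partition_def remove_part_def)
  qed
qed

lemma conj_partition_zero: "conj_partition (\<lambda>_. 0) = (\<lambda>_. 0)"
  by (simp add: conj_partition_def fun_eq_iff)

lemma zero_partition: "(\<lambda>_. 0) \<in> partitions"
  by (auto simp: partitions_def int_vec_def monotone_def)

section \<open>Row operations on the determinants \<open>s_alpha\<close>\<close>

section \<open>Generalized Schur functions of integer vectors\<close>

text \<open>In a row \<open>i\<close> with part 0 the entries are \<open>h j (- i)\<close>: zero
  left of the diagonal and 1 on it. This makes the determinants stabilise.\<close>

locale unitriangular =
  fixes h :: "int \<Rightarrow> int \<Rightarrow> B"
  assumes h_one: "h k (- k) = 1"
    and h_zero: "k + r < 0 \<Longrightarrow> h r k = 0"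
begin

lemma schur_det_Suc:
  assumes "a N = 0"
  shows "schur_det h a (Suc N) = schur_det h a N"
proof -
  let ?A = "mat (Suc N) (Suc N) (\<lambda>(i, j). h (int j) (a i - int i))"
  have "det ?A = (\<Sum>j<Suc N. ?A $$ (N, j) * cofactor ?A N j)"
    by (rule laplace_expansion_row) auto
  also have "\<dots> = ?A $$ (N, N) * cofactor ?A N N"
    using assms by (simp add: h_zero)
  also have "?A $$ (N, N) = 1"
    using assms h_one[of "int N"] by simp
  also have "cofactor ?A N N = det (mat_delete ?A N N)"
    by (simp add: cofactor_def)
  also have "mat_delete ?A N N = mat N N (\<lambda>(i, j). h (int j) (a i - int i))"
    by (rule eq_matI) (auto simp: mat_delete_def)
  finally show ?thesis
    by (simp add: schur_det_def)
qed

text \<open>The determinants are constant from size \<open>l\<close> on, so any such size computes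
  the stable value. This allows vectors of different lengths to be compared at a common
  size.\<close>

lemma gschur_eq:
  assumes "int_vec a l" "l \<le> N"
  shows "gschur h a = schur_det h a N"
proof -
  have *: "schur_det h a M = schur_det h a l" if "l \<le> M" for M
    using that
    by (induction M rule: dec_induct) (use assms in \<open>auto simp: schur_det_Suc int_vec_def\<close>)
  have "eventually (\<lambda>M. schur_det h a M = schur_det h a l) sequentially"
    unfolding eventually_sequentially using * by blast
  moreover have "s = schur_det h a l" if s: "eventually (\<lambda>M. schur_det h a M = s) sequentially" for s
  proof -
    obtain M where "\<forall>n\<ge>M. schur_det h a n = s"
      using s unfolding eventually_sequentially by blast
    then show ?thesis
      using *[of "max M l"] by simp
  qed
  ultimately have "gschur h a = schur_det h a l"
    unfolding gschur_def by (rule the_equality)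
  then show ?thesis
    using *[OF assms(2)] by simp
qed

text \<open>Row \<open>i\<close> depends only on \<open>a i - i\<close>, and passing from
  \<open>a\<close> to \<open>b\<close> exchanges these numbers at \<open>p\<close> and
  \<open>Suc p\<close>.\<close>

lemma schur_det_swap:
  assumes "Suc p < N" "b p = a (Suc p) - 1" "b (Suc p) = a p + 1"
    "\<And>i. i \<noteq> p \<Longrightarrow> i \<noteq> Suc p \<Longrightarrow> b i = a i"
  shows "schur_det h b N = - schur_det h a N"
proof -
  let ?A = "mat N N (\<lambda>(i, j). h (int j) (a i - int i))"
  have "b i - int i = (if i = p then a (Suc p) - int (Suc p)
      else if i = Suc p then a p - int p else a i - int i)" for i
    using assms by auto
  then have "mat N N (\<lambda>(i, j). h (int j) (b i - int i)) = swaprows p (Suc p) ?A"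
    using assms(1) by (intro eq_matI) (auto simp: mat_swaprows_def)
  then show ?thesis
    unfolding schur_det_def using assms(1) det_swaprows[of p N "Suc p" ?A] by simp
qed

lemma gschur_prepend_insert_part:
  assumes "int_vec lam l"
  shows "gschur h (prepend a lam) = (- 1) ^ p * gschur h (insert_part p a lam)"
proof (induction p)
  case 0
  then show ?case by (simp add: insert_part_0)
next
  case (Suc p)
  have vec: "int_vec (insert_part q a lam) (Suc (l + q))" for q
    using assms by (auto simp: int_vec_def insert_part_def)
  \<comment> \<open>The size \<open>l + p + 2\<close> covers the supports of both vectors and
    contains the two rows to be exchanged.\<close>
  have "gschur h (insert_part p a lam) = schur_det h (insert_part p a lam) (l + p + 2)"
    by (rule gschur_eq[OF vec]) simp
  also have "\<dots> = - schur_det h (insert_part (Suc p) a lam) (l + p + 2)"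
    by (rule schur_det_swap[where p = p]) (auto simp: insert_part_def)
  also have "schur_det h (insert_part (Suc p) a lam) (l + p + 2) =
      gschur h (insert_part (Suc p) a lam)"
    by (rule gschur_eq[OF vec, symmetric]) simp
  finally show ?case
    using Suc by simp
qed

text \<open>The prepended row coincides with row \<open>Suc q\<close>, the new place of the old row
  \<open>q\<close>.\<close>

lemma gschur_prepend_eq_0:
  assumes "int_vec lam l" "a = lam q - int q - 1"
  shows "gschur h (prepend a lam) = 0"
proof -
  define N where "N = l + q + 2"
  let ?A = "mat N N (\<lambda>(i, j). h (int j) (prepend a lam i - int i))"
  have "int_vec (prepend a lam) (Suc l)"
    using assms by (auto simp: int_vec_def prepend_def split: nat.splits)
  then have "gschur h (prepend a lam) = det ?A"
    by (subst gschur_eq[where N = N]) (auto simp: N_def schur_det_def)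
  also have "\<dots> = 0"
  proof (rule det_identical_rows[where i = 0 and j = "Suc q"])
    show "row ?A 0 = row ?A (Suc q)"
      by (rule eq_vecI) (auto simp: N_def prepend_def assms(2) algebra_simps)
  qed (auto simp: N_def)
  finally show ?thesis .
qed

text \<open>Straightening: an occupied index gives two equal rows, and a free one is sorted by one
  exchange for each bead above it.\<close>

lemma gschurz_prepend:
  fixes k m :: int
  assumes "lam \<in> partitions"
  defines "p \<equiv> num_above k (maya lam m)"
  shows "gschurz h (prepend (k - m - 1) lam) n =
    (if k \<in> maya lam m then 0 else (- 1) ^ p * gschurz h (insert_part p (k - m - 1) lam) n)"
proof -
  obtain l where l: "int_vec lam l"
    using assms(1) by (rule partitionsE)
  show ?thesis
  proof (cases "k \<in> maya lam m")
    case True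
    then obtain q where "k - m - 1 = lam q - int q - 1"
      by (auto simp: maya_def beads_def)
    from gschur_prepend_eq_0[OF l this] True show ?thesis
      by (simp add: gschurz_def)
  next
    case False
    then show ?thesis
      using gschur_prepend_insert_part[OF l, of "k - m - 1" p]
      by (cases "even p") (simp_all add: gschurz_def single_uminus)
  qed
qed

lemma gschur_zero: "gschur h (\<lambda>_. 0) = 1"
proof -
  \<comment> \<open>The zero vector may be evaluated at size 0, where the determinant is
    empty.\<close>
  have "gschur h (\<lambda>_. 0) = schur_det h (\<lambda>_. 0) 0"
    by (rule gschur_eq[where l = 0]) (auto simp: int_vec_def)
  then show ?thesis
    by (simp add: schur_det_def)
qed

end

section \<open>The operators on basis vectors and the Clifford relations\<close>

section \<open>Fermions\<close>

text \<open>Independence of the image set does not exclude repetitions, so injectivity is a separate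
  part of being a basis indexed by partitions.\<close>

locale schur_basis = unitriangular +
  assumes schur_inj: "inj_on (gschur h) partitions"
    and schur_independent: "B.independent (gschur h ` partitions)"
    and schur_span: "B.span (gschur h ` partitions) = UNIV"
begin

text \<open>The exponent of \<open>z\<close> can be read off because an independent set does not
  contain 0.\<close>

lemma gschurz_inject:
  assumes "lam \<in> partitions" "mu \<in> partitions" "gschurz h lam m = gschurz h mu n"
  shows "lam = mu" "m = n"
proof -
  have "gschur h lam \<noteq> 0"
    using assms(1) schur_independent B.dependent_zero by (metis imageI)
  then show "m = n"
    using assms(3) unfolding gschurz_def by (metis lookup_single_eq lookup_single_not_eq)
  with assms show "lam = mu"
    using inj_onD[OF schur_inj, of lam mu] unfolding gschurz_def by (metis lookup_single_eq)
qed

lemma gschurz_set_eq: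
  "{gschurz h lam m | lam m. lam \<in> partitions} =
   {Poly_Mapping.single m x | m x. x \<in> gschur h ` partitions}"
  by (auto simp: gschurz_def)

lemma linear_eqI:
  assumes "Vector_Spaces.linear scaleBZ scaleBZ T" "Vector_Spaces.linear scaleBZ scaleBZ U"
    and "\<And>lam m. lam \<in> partitions \<Longrightarrow> T (gschurz h lam m) = U (gschurz h lam m)"
  shows "T v = U v"
proof (rule BZZ.linear_eq_on[OF assms(1,2)])
  show "v \<in> BZ.span {gschurz h lam m | lam m. lam \<in> partitions}"
    using span_single[OF schur_span] unfolding gschurz_set_eq by simp
qed (use assms(3) in auto)

text \<open>This justifies the descriptions by \<open>THE\<close>: values on a basis extend to
  exactly one linear operator.\<close>

lemma ex1_linear:
  "\<exists>!T. Vector_Spaces.linear scaleBZ scaleBZ T \<and>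
     (\<forall>lam\<in>partitions. \<forall>m. T (gschurz h lam m) = f lam m)"
proof (rule ex_ex1I)
  \<comment> \<open>Prescribed values must be a function of the basis vector, so its label is
    recovered by an inverse.\<close>
  let ?idx = "inv_into (partitions \<times> UNIV) (\<lambda>(lam, m). gschurz h lam m)"
  have inj: "inj_on (\<lambda>(lam, m). gschurz h lam m) (partitions \<times> UNIV)"
    by (rule inj_onI) (auto dest: gschurz_inject)
  have "BZ.independent {gschurz h lam m | lam m. lam \<in> partitions}"
    using independent_single[OF schur_independent] unfolding gschurz_set_eq .
  from BZZ.linear_independent_extend[OF this, of "\<lambda>v. case_prod f (?idx v)"]
  obtain T where T: "Vector_Spaces.linear scaleBZ scaleBZ T"
    "\<forall>v\<in>{gschurz h lam m | lam m. lam \<in> partitions}. T v = case_prod f (?idx v)"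
    by blast
  have "T (gschurz h lam m) = f lam m" if "lam \<in> partitions" for lam m
  proof -
    have "T (gschurz h lam m) = case_prod f (?idx (gschurz h lam m))"
      using T(2) that by blast
    also have "?idx (gschurz h lam m) = (lam, m)"
      using inv_into_f_f[OF inj, of "(lam, m)"] that by simp
    finally show ?thesis by simp
  qed
  with T(1) show "\<exists>T. Vector_Spaces.linear scaleBZ scaleBZ T \<and>
     (\<forall>lam\<in>partitions. \<forall>m. T (gschurz h lam m) = f lam m)"
    by blast
next
  fix T U
  assume "Vector_Spaces.linear scaleBZ scaleBZ T \<and>
      (\<forall>lam\<in>partitions. \<forall>m. T (gschurz h lam m) = f lam m)"
    "Vector_Spaces.linear scaleBZ scaleBZ U \<and>
      (\<forall>lam\<in>partitions. \<forall>m. U (gschurz h lam m) = f lam m)"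
  then show "T = U"
    by - (rule ext, rule linear_eqI, auto)
qed

text \<open>The shape of the premise lets the definitions of \<open>psi\<close> and
  \<open>psi_star\<close> be plugged in directly.\<close>

lemma the_linear:
  assumes "T = (THE T. Vector_Spaces.linear scaleBZ scaleBZ T \<and>
     (\<forall>lam\<in>partitions. \<forall>m. T (gschurz h lam m) = f lam m))"
  shows "Vector_Spaces.linear scaleBZ scaleBZ T"
    and "lam \<in> partitions \<Longrightarrow> T (gschurz h lam m) = f lam m"
  using theI'[OF ex1_linear[of f]] unfolding assms[symmetric] by blast+

lemmas linear_psi = the_linear(1)[OF psi_def]
  and psi_gschurz = the_linear(2)[OF psi_def]
  and linear_psi_star = the_linear(1)[OF psi_star_def]
  and psi_star_gschurz = the_linear(2)[OF psi_star_def]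

text \<open>Beads are distinct, so only the summand at \<open>t\<close> survives.\<close>

lemma psi_star_gschurz_bead:
  assumes "lam \<in> partitions" "k = beads lam m t"
  shows "psi_star h k (gschurz h lam m) = (- 1) ^ t * gschurz h (remove_part t lam) (m - 1)"
proof -
  have "k - m - 1 = lam t' - (int t' + 1) \<longleftrightarrow> t' = t" for t'
    using beads_eq_iff[OF assms(1), of m t' t] assms(2) by (auto simp: beads_def)
  then show ?thesis
    unfolding psi_star_gschurz[OF assms(1)] by (simp only: Sum_any.delta)
qed

definition diagrams :: "int set set" where
  "diagrams = {maya lam m | lam m. lam \<in> partitions}"

text \<open>The semi-infinite wedge with index set \<open>S\<close>. The label is unique by
  \<open>maya_inject\<close>; outside \<open>diagrams\<close> the value is unspecified.\<close>

definition state :: "int set \<Rightarrow> BZ" where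
  "state S = (case inv_into (partitions \<times> UNIV) (\<lambda>(lam, m). maya lam m) S of
     (lam, m) \<Rightarrow> gschurz h lam m)"

lemma state_maya:
  assumes "lam \<in> partitions"
  shows "state (maya lam m) = gschurz h lam m"
proof -
  have "inj_on (\<lambda>(lam, m). maya lam m) (partitions \<times> UNIV)"
    by (rule inj_onI) (auto dest: maya_inject)
  from inv_into_f_f[OF this, of "(lam, m)"] show ?thesis
    using assms by (simp add: state_def)
qed

lemma diagrams_insert:
  assumes "S \<in> diagrams"
  shows "insert k S \<in> diagrams"
proof (cases "k \<in> S")
  case True
  with assms show ?thesis by (simp add: insert_absorb)
next
  case False
  obtain lam m where lam: "lam \<in> partitions" "S = maya lam m"
    using assms by (auto simp: diagrams_def)
  show ?thesis
    using insert_bead[OF lam(1), of k m] False unfolding lam(2) diagrams_def by blast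
qed

lemma diagrams_remove:
  assumes "S \<in> diagrams"
  shows "S - {k} \<in> diagrams"
proof (cases "k \<in> S")
  case True
  obtain lam m where lam: "lam \<in> partitions" "S = maya lam m"
    using assms by (auto simp: diagrams_def)
  with True obtain t where "k = beads lam m t"
    by (auto simp: maya_def)
  then have "S - {k} = maya (remove_part t lam) (m - 1)"
    using remove_bead(2)[OF lam(1), of t m] lam(2) by simp
  with remove_bead(1)[OF lam(1), of t] show ?thesis
    unfolding diagrams_def by blast
next
  case False
  with assms show ?thesis by simp
qed

lemma finite_above_diagrams: "S \<in> diagrams \<Longrightarrow> finite {x\<in>S. k < x}"
  using finite_above by (auto simp: diagrams_def)

text \<open>Exterior multiplication by the vector \<open>k\<close>: the straightening sign comes
  from \<open>gschurz_prepend\<close>, the new index set from \<open>insert_bead\<close>.\<close>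

lemma psi_state:
  assumes "S \<in> diagrams"
  shows "psi h k (state S) = (if k \<in> S then 0 else (- 1) ^ num_above k S * state (insert k S))"
proof -
  obtain lam m where lam: "lam \<in> partitions" "S = maya lam m"
    using assms by (auto simp: diagrams_def)
  show ?thesis
    using insert_bead[OF lam(1), of k m]
      state_maya[of "insert_part (num_above k (maya lam m)) (k - m - 1) lam" "m + 1"]
    by (auto simp: lam(2) state_maya[OF lam(1)] psi_gschurz[OF lam(1)] gschurz_prepend[OF lam(1)])
qed

text \<open>Contraction with the vector \<open>k\<close>: the row \<open>t\<close> of the bead
  \<open>k\<close> equals the number of beads above it, so the sign in the defining sum is the
  expected one.\<close>

lemma psi_star_state:
  assumes "S \<in> diagrams"
  shows "psi_star h k (state S) = (if k \<in> S then (- 1) ^ num_above k S * state (S - {k}) else 0)"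
proof -
  obtain lam m where lam: "lam \<in> partitions" "S = maya lam m"
    using assms by (auto simp: diagrams_def)
  show ?thesis
  proof (cases "k \<in> S")
    case True
    then obtain t where t: "k = beads lam m t"
      by (auto simp: lam maya_def)
    have "num_above k S = t"
      unfolding lam(2) t by (rule num_above_beads) (simp_all add: lam beads_less_iff)
    moreover have "state (S - {k}) = gschurz h (remove_part t lam) (m - 1)"
      using remove_bead[OF lam(1), of t] by (simp add: lam(2) t flip: state_maya)
    ultimately show ?thesis
      using True psi_star_gschurz_bead[OF lam(1) t] by (simp add: lam state_maya)
  next
    case False
    then have "k \<noteq> beads lam m t" for t
      by (auto simp: lam maya_def)
    then have "k - m - 1 \<noteq> lam t - (int t + 1)" for t
      by (simp add: beads_def algebra_simps)
    with False show ?thesis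
      by (simp add: lam state_maya psi_star_gschurz)
  qed
qed

lemma linear_eqI_states:
  assumes "Vector_Spaces.linear scaleBZ scaleBZ T" "Vector_Spaces.linear scaleBZ scaleBZ U"
    and "\<And>S. S \<in> diagrams \<Longrightarrow> T (state S) = U (state S)"
  shows "T v = U v"
proof (rule linear_eqI[OF assms(1,2)])
  show "T (gschurz h lam m) = U (gschurz h lam m)" if "lam \<in> partitions" for lam m
    using assms(3)[of "maya lam m"] that by (auto simp: diagrams_def state_maya)
qed

lemma linear_anticommutator:
  assumes T: "Vector_Spaces.linear scaleBZ scaleBZ T" and U: "Vector_Spaces.linear scaleBZ scaleBZ U"
  shows "Vector_Spaces.linear scaleBZ scaleBZ (\<lambda>v. T (U v) + U (T v))"
  using BZZ.linear_compose_add[OF Vector_Spaces.linear_compose[OF U T]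
      Vector_Spaces.linear_compose[OF T U]]
  by (simp add: o_def)

lemma psi_psi: "psi h k (psi h l v) + psi h l (psi h k v) = 0"
proof (rule linear_eqI_states[of "\<lambda>v. psi h k (psi h l v) + psi h l (psi h k v)" "\<lambda>_. 0"])
  fix S assume S: "S \<in> diagrams"
  \<comment> \<open>Stated for all \<open>k\<close> and \<open>l\<close>, so that it covers both
    orders of the product.\<close>
  have prod: "psi h k (psi h l (state S)) = (if k = l \<or> k \<in> S \<or> l \<in> S then 0
      else (- 1) ^ (num_above l S + num_above k (insert l S)) * state (insert k (insert l S)))" for k l
    by (simp add: S psi_state diagrams_insert minus_one_power_commute[OF linear_psi]
        BZZ.linear_0[OF linear_psi] power_add mult.assoc)
  show "psi h k (psi h l (state S)) + psi h l (psi h k (state S)) = 0"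
  proof (cases "k = l \<or> k \<in> S \<or> l \<in> S")
    case True
    then show ?thesis by (auto simp: prod)
  next
    case False
    \<comment> \<open>Exactly one of \<open>k < l\<close> and \<open>l < k\<close> holds, so in
      exactly one order the bead inserted first adds one to the second count.\<close>
    then have "odd (num_above l S + num_above k (insert l S) + (num_above k S + num_above l (insert k S)))"
      by (auto simp: num_above_insert finite_above_diagrams S)
    from signs_cancel[OF this] False show ?thesis
      by (simp add: prod insert_commute[of l k])
  qed
next
  show "Vector_Spaces.linear scaleBZ scaleBZ (\<lambda>v. psi h k (psi h l v) + psi h l (psi h k v))"
    by (rule linear_anticommutator[OF linear_psi linear_psi])
next
  show "Vector_Spaces.linear scaleBZ scaleBZ (\<lambda>_. 0)"
    by (rule BZZ.linear_zero)
qed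


lemma psi_star_psi_star: "psi_star h k (psi_star h l v) + psi_star h l (psi_star h k v) = 0"
proof (rule linear_eqI_states[of
      "\<lambda>v. psi_star h k (psi_star h l v) + psi_star h l (psi_star h k v)" "\<lambda>_. 0"])
  fix S assume S: "S \<in> diagrams"
  have prod: "psi_star h k (psi_star h l (state S)) =
      (if k \<noteq> l \<and> k \<in> S \<and> l \<in> S
       then (- 1) ^ (num_above l S + num_above k (S - {l})) * state (S - {l} - {k}) else 0)" for k l
    by (cases "l \<in> S")
      (auto simp: psi_star_state[OF S] psi_star_state[OF diagrams_remove[OF S]]
        minus_one_power_commute[OF linear_psi_star] BZZ.linear_0[OF linear_psi_star]
        power_add mult.assoc)
  show "psi_star h k (psi_star h l (state S)) + psi_star h l (psi_star h k (state S)) = 0"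
  proof (cases "k \<noteq> l \<and> k \<in> S \<and> l \<in> S")
    case True
    \<comment> \<open>In exactly one order the first removal lowers the second count by one.\<close>
    then have "odd (num_above l S + num_above k (S - {l}) + (num_above k S + num_above l (S - {k})))"
      by (auto simp: num_above_remove[of S k l] num_above_remove[of S l k] finite_above_diagrams S)
    from signs_cancel[OF this] True show ?thesis
      by (simp add: prod Diff_insert2[symmetric] insert_commute[of l k])
  next
    case False
    then show ?thesis by (auto simp: prod)
  qed
qed (rule linear_anticommutator[OF linear_psi_star linear_psi_star] BZZ.linear_zero)+

text \<open>For \<open>k = l\<close> exactly one of the two products survives on each state,
  according to whether \<open>k\<close> is occupied. For \<open>k \<noteq> l\<close> both need
  \<open>l\<close> occupied and \<open>k\<close> free, and their signs are opposite.\<close>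

lemma psi_psi_star:
  "psi h k (psi_star h l v) + psi_star h l (psi h k v) = (if k = l then v else 0)"
proof (rule linear_eqI_states[of
      "\<lambda>v. psi h k (psi_star h l v) + psi_star h l (psi h k v)" "\<lambda>v. if k = l then v else 0"])
  fix S assume S: "S \<in> diagrams"
  note simps = S psi_state psi_star_state diagrams_remove diagrams_insert
    minus_one_power_commute[OF linear_psi_star] minus_one_power_commute[OF linear_psi]
    BZZ.linear_0[OF linear_psi] BZZ.linear_0[OF linear_psi_star]
  have prod1: "psi h k (psi_star h l (state S)) = (if l \<in> S \<and> (k = l \<or> k \<notin> S)
      then (- 1) ^ (num_above l S + num_above k (S - {l})) * state (insert k (S - {l})) else 0)" for k l
    by (auto simp: simps power_add mult.assoc)
  have prod2: "psi_star h l (psi h k (state S)) = (if k \<notin> S \<and> (k = l \<or> l \<in> S)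
      then (- 1) ^ (num_above k S + num_above l (insert k S)) * state (insert k S - {l}) else 0)" for k l
    by (auto simp: simps power_add mult.assoc)
  show "psi h k (psi_star h l (state S)) + psi_star h l (psi h k (state S)) =
      (if k = l then state S else 0)"
  proof (cases "k = l")
    case True
    \<comment> \<open>The bead \<open>k\<close> is not strictly above itself, so the same sign
      occurs twice and squares to 1.\<close>
    have "num_above k (insert k S) = num_above k S" if "k \<notin> S"
      using num_above_insert[OF finite_above_diagrams[OF S] that, of k] by simp
    moreover have "num_above k (S - {k}) = num_above k S" if "k \<in> S"
      using num_above_remove[OF finite_above_diagrams[OF S] that, of k] by simp
    ultimately show ?thesis
      using True by (auto simp: prod1 prod2 insert_absorb)
  next
    case neq: False
    show ?thesis
    proof (cases "l \<in> S \<and> k \<notin> S")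
      case True
      then have "odd (num_above l S + num_above k (S - {l}) + (num_above k S + num_above l (insert k S)))"
        using neq
        by (auto simp: num_above_remove[of S k l] num_above_insert[of S l k] finite_above_diagrams S)
      from signs_cancel[OF this] True neq show ?thesis
        by (simp add: prod1 prod2 insert_Diff_if)
    next
      case False
      with neq show ?thesis
        by (auto simp: prod1 prod2)
    qed
  qed
next
  show "Vector_Spaces.linear scaleBZ scaleBZ (\<lambda>v. if k = l then v else 0)"
    by (cases "k = l") (simp_all add: BZZ.linear_zero BZ.linear_ident)
qed (rule linear_anticommutator[OF linear_psi linear_psi_star])

section \<open>Products of operators applied to \<open>1\<close>, one row at a time\<close>

section \<open>Vectors generated from the vacuum\<close>

lemma gschurz_vacuum: "gschurz h (\<lambda>_. 0) 0 = 1"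
  by (simp add: gschurz_def gschur_zero)

text \<open>Downward induction on \<open>j\<close>, as \<open>foldr\<close> applies the last
  operator first. At charge \<open>l - Suc j\<close> the operator prepends exactly
  \<open>lam j\<close>; the result is again a partition, so no sign appears.\<close>

lemma psi_vacuum:
  assumes lam: "lam \<in> partitions" "int_vec lam l" and "j \<le> l"
  shows "foldr (\<lambda>i. psi h (lam i + int (l - i))) [j..<l] 1 =
    gschurz h (\<lambda>i. lam (i + j)) (int (l - j))"
  using assms(3)
proof (induction j rule: inc_induct)
  case base
  have "(\<lambda>i. lam (i + l)) = (\<lambda>_. 0)"
    using lam(2) by (auto simp: int_vec_def)
  then show ?case
    by (simp add: gschurz_vacuum)
next
  case (step j)
  have "prepend (lam j) (\<lambda>i. lam (i + Suc j)) = (\<lambda>i. lam (i + j))"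
    by (auto simp: prepend_def fun_eq_iff split: nat.splits)
  with step show ?case
    by (simp add: upt_conv_Cons psi_gschurz[OF partitions_shift[OF lam(1), of "Suc j", simplified]]
        of_nat_diff)
qed

text \<open>Both claims are proved together, since evaluating \<open>psi_star\<close> requires the
  current vector to be a partition. Each step is \<open>conj_partition_Suc\<close> for a tail of
  \<open>lam\<close>.\<close>

lemma psi_star_vacuum:
  assumes lam: "lam \<in> partitions" "int_vec lam l" and "j \<le> l"
  shows "conj_partition (\<lambda>i. lam (i + j)) \<in> partitions"
    and "foldr (\<lambda>i. psi_star h (- lam i - int (l - i) + 1)) [j..<l] 1 =
      (- 1) ^ nat (\<Sum>i=j..<l. lam i) *
        gschurz h (conj_partition (\<lambda>i. lam (i + j))) (- int (l - j))"
  using assms(3)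
proof (induction j rule: inc_induct)
  case base
  have "(\<lambda>i. lam (i + l)) = (\<lambda>_. 0)"
    using lam(2) by (auto simp: int_vec_def)
  then show "conj_partition (\<lambda>i. lam (i + l)) \<in> partitions"
    and "foldr (\<lambda>i. psi_star h (- lam i - int (l - i) + 1)) [l..<l] 1 =
      (- 1) ^ nat (\<Sum>i=l..<l. lam i) *
        gschurz h (conj_partition (\<lambda>i. lam (i + l))) (- int (l - l))"
    by (simp_all add: conj_partition_zero zero_partition gschurz_vacuum)
next
  case (step j)
  let ?mu = "conj_partition (\<lambda>i. lam (i + Suc j))"
  have nonneg: "0 \<le> lam i" for i
    using lam(1) by (auto simp: partitions_def)
  have conj: "conj_partition (\<lambda>i. lam (i + j)) = remove_part (nat (lam j)) ?mu"
    using conj_partition_Suc[OF partitions_shift[OF lam(1), of j]] by simp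
  then show "conj_partition (\<lambda>i. lam (i + j)) \<in> partitions"
    using remove_bead(1)[OF step.IH(1)] by simp
  have "\<not> int (nat (lam j)) + 1 \<le> lam (i + Suc j)" for i
    using lam(1) antimonoD[of lam j "i + Suc j"] nonneg[of j] by (auto simp: partitions_def)
  then have "{i. int (nat (lam j)) + 1 \<le> lam (i + Suc j)} = {}"
    by blast
  \<comment> \<open>The later rows have length at most \<open>lam j\<close>, so column
    \<open>lam j\<close>, counted from 0, is empty.\<close>
  then have "?mu (nat (lam j)) = 0"
    by (simp add: conj_partition_def)
  \<comment> \<open>Hence the index of the operator is the bead of this zero part, and the
    contraction contributes the sign with exponent \<open>lam j\<close>.\<close>
  then have "- lam j - int (l - j) + 1 = beads ?mu (- int (l - Suc j)) (nat (lam j))"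
    using nonneg[of j] step.hyps by (simp add: beads_def of_nat_diff)
  note bead = psi_star_gschurz_bead[OF step.IH(1) this]
  have sum: "nat (\<Sum>i=j..<l. lam i) = nat (\<Sum>i=Suc j..<l. lam i) + nat (lam j)"
    using step.hyps nonneg
    by (subst sum.atLeast_Suc_lessThan) (auto simp: nat_add_distrib sum_nonneg)
  have charge: "- int (l - Suc j) - 1 = - int (l - j)"
    using step.hyps by simp
  let ?op = "\<lambda>i. psi_star h (- lam i - int (l - i) + 1)"
  have "foldr ?op [j..<l] 1 = ?op j (foldr ?op [Suc j..<l] 1)"
    using step.hyps by (simp add: upt_conv_Cons)
  also have "\<dots> = (- 1) ^ nat (\<Sum>i=Suc j..<l. lam i) *
      ?op j (gschurz h ?mu (- int (l - Suc j)))"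
    unfolding step.IH(2) minus_one_power_commute[OF linear_psi_star] ..
  also have "\<dots> = (- 1) ^ nat (\<Sum>i=j..<l. lam i) *
      gschurz h (conj_partition (\<lambda>i. lam (i + j))) (- int (l - j))"
    unfolding bead charge conj sum by (simp only: power_add mult.assoc)
  finally show "foldr ?op [j..<l] 1 = (- 1) ^ nat (\<Sum>i=j..<l. lam i) *
      gschurz h (conj_partition (\<lambda>i. lam (i + j))) (- int (l - j))" .
qed

end

text \<open>Rows are counted from 0, so the operator for \<open>i = 0\<close> is outermost in
  \<open>foldr\<close> and has index \<open>lambda_1 + l\<close>, respectively
  \<open>- lambda_1 - l + 1\<close>. Trailing zero parts are allowed in \<open>l\<close>.\<close>

theorem proposition4p1:
  fixes h :: "int \<Rightarrow> int \<Rightarrow> B"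
  assumes h0_pos: "\<And>n. 0 < n \<Longrightarrow> h 0 (int n) = hvar n"
    and h0_zero: "h 0 0 = 1"
    and h0_neg: "\<And>k. k < 0 \<Longrightarrow> h 0 k = 0"
    and h_filtered: "\<And>r k. h r k \<in> B_le (k + r)"
    and h_one: "\<And>k. h k (- k) = 1"
    and h_zero: "\<And>r k. k + r < 0 \<Longrightarrow> h r k = 0"
    and schur_inj: "inj_on (gschur h) partitions"
    and schur_independent: "B.independent (gschur h ` partitions)"
    and schur_span: "B.span (gschur h ` partitions) = UNIV"
  shows "(\<forall>k l v.
            psi h k (psi h l v) + psi h l (psi h k v) = 0 \<and>
            psi_star h k (psi_star h l v) + psi_star h l (psi_star h k v) = 0 \<and>
            psi h k (psi_star h l v) + psi_star h l (psi h k v) = (if k = l then v else 0)) \<and>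
         (\<forall>lam l. lam \<in> partitions \<longrightarrow> int_vec lam l \<longrightarrow>
            foldr (\<lambda>i. psi h (lam i + int (l - i))) [0..<l] 1 = gschurz h lam (int l) \<and>
            foldr (\<lambda>i. psi_star h (- lam i - int (l - i) + 1)) [0..<l] 1 =
              (- 1) ^ nat (\<Sum>i<l. lam i) * gschurz h (conj_partition lam) (- int l))"
proof -
  interpret schur_basis h
    by unfold_locales (fact h_one h_zero schur_inj schur_independent schur_span)+
  show ?thesis
  proof (intro conjI allI impI)
    fix lam l
    assume lam: "lam \<in> partitions" "int_vec lam l"
    show "foldr (\<lambda>i. psi h (lam i + int (l - i))) [0..<l] 1 = gschurz h lam (int l)"
      using psi_vacuum[OF lam, of 0] by simp
    show "foldr (\<lambda>i. psi_star h (- lam i - int (l - i) + 1)) [0..<l] 1 =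
        (- 1) ^ nat (\<Sum>i<l. lam i) * gschurz h (conj_partition lam) (- int l)"
      using psi_star_vacuum(2)[OF lam, of 0] by (simp add: lessThan_atLeast0)
  qed (rule psi_psi psi_star_psi_star psi_psi_star)+
qed

end
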